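(* Let $\zeta,\eta\ge 0$, let $\chi\in[1,2]$ and $\mathrm{p}\ge\chi$, let $\mathfrak{X}(v,\varpi)$ be a symmetric stable process of index $\chi$, and let $Y_{\zeta,\eta}(v,\varpi)=\int_{-1}^{v}\varrho^{(\zeta,\eta)}(s)\,d\mathfrak{X}(s,\varpi)$ for $v\in[-1,1]$. If $\mathfrak{g}\in \mathrm{L}_{[-1,1]}^{\mathrm{p}}(d\mu_{\zeta,\eta})$, then the integral $$\int_{-1}^1\mathfrak{g}(v)\,dY_{\zeta,\eta}(v,\varpi)$$ can be defined in probability. That is, for every sequence $(\mathfrak{g}_m)$ of continuous functions on $[-1,1]$ with $\lim_{m\to\infty}\int_{-1}^1|\mathfrak{g}_m(v)-\mathfrak{g}(v)|^{\mathrm{p}}\,d\mu_{\zeta,\eta}(v)=0$, the random variables $\int_{-1}^1\mathfrak{g}_m(v)\,dY_{\zeta,\eta}(v,\varpi)$ converge in probability as $m\to\infty$ to a random variable which (up to almost sure equality) does not depend on the choice of the sequence $(\mathfrak{g}_m)$.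
   Context: Notation: $\varrho^{(\zeta,\eta)}(v)=(1-v)^\zeta(1+v)^\eta$ on $[-1,1]$ and $d\mu_{\zeta,\eta}(v)=\varrho^{(\zeta,\eta)}(v)\,dv$. $\mathrm{L}_{[-1,1]}^{\mathrm{p}}(d\mu_{\zeta,\eta})$ is the space of (real-valued) measurable functions $\mathfrak{g}$ on $[-1,1]$ with $\int_{-1}^1|\mathfrak{g}|^{\mathrm{p}}\,d\mu_{\zeta,\eta}<\infty$. A symmetric stable process $\mathfrak{X}(v,\varpi)$, $v\in\mathbb{R}$, of index $\chi$ is a process continuous in probability with independent stationary increments such that $E\exp\big(it(\mathfrak{X}(v)-\mathfrak{X}(w))\big)=\exp(-K|v-w||t|^\chi)$ for all real $t,v,w$, with some constant $K>0$. For $h$ continuous on $[a,b]$, $\int_a^b h\,d\mathfrak{X}$ is the limit in probability of Riemann–Stieltjes sums. For $h$ continuous on $[-1,1]$, $\int_{-1}^1 h(v)\,dY_{\zeta,\eta}(v,\varpi)=\int_{-1}^1h(v)\varrho^{(\zeta,\eta)}(v)\,d\mathfrak{X}(v,\varpi)$. *)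

theory Defs
  imports "HOL-Probability.Probability"
begin

definition tendsto_in_prob ::
    "'w measure \<Rightarrow> ('i \<Rightarrow> 'w \<Rightarrow> real) \<Rightarrow> ('w \<Rightarrow> real) \<Rightarrow> 'i filter \<Rightarrow> bool" where
  "tendsto_in_prob M Z L F \<longleftrightarrow>
     (\<forall>\<epsilon>>0. ((\<lambda>i. measure M {\<omega> \<in> space M. \<bar>Z i \<omega> - L \<omega>\<bar> > \<epsilon>}) \<longlongrightarrow> 0) F)"

text \<open>The value of \<open>X 0\<close> is left unspecified: only the increments of the process are constrained.\<close>

locale symmetric_stable_process = prob_space M
  for M :: "'w measure" and X :: "real \<Rightarrow> 'w \<Rightarrow> real" and \<alpha> :: real +
  assumes random_variable_X: "X v \<in> borel_measurable M"
    and continuous_in_prob: "tendsto_in_prob M X (X v) (at v)"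
    and independent_increments:
      "\<And>(n::nat) t. mono_on {..n} t \<Longrightarrow>
         indep_vars (\<lambda>_. borel) (\<lambda>i \<omega>. X (t (Suc i)) \<omega> - X (t i) \<omega>) {..<n}"
    and stationary_increments:
      "distr M borel (\<lambda>\<omega>. X (v + h) \<omega> - X (w + h) \<omega>) = distr M borel (\<lambda>\<omega>. X v \<omega> - X w \<omega>)"
    and char_increments:
      "\<exists>K>0. \<forall>t v w. (CLINT \<omega>|M. iexp (t * (X v \<omega> - X w \<omega>))) =
         complex_of_real (exp (- K * \<bar>v - w\<bar> * \<bar>t\<bar> powr \<alpha>))"

text \<open>
  Tagged divisions of \<open>[a, b]\<close> whose mesh tends to \<open>0\<close>. This is uniform refinement, in contrast
  to the gauge refinement of \<^const>\<open>division_filter\<close>, which underlies the Henstock-Kurzweil integral.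
\<close>

definition mesh_filter :: "real \<Rightarrow> real \<Rightarrow> (real \<times> real set) set filter" where
  "mesh_filter a b = (INF \<delta>\<in>{0<..}. principal
     {D. D tagged_division_of {a..b} \<and> (\<forall>(x, K)\<in>D. Sup K - Inf K < \<delta>)})"

lemma eventually_mesh_filter:
  "eventually P (mesh_filter a b) \<longleftrightarrow>
     (\<exists>\<delta>>0. \<forall>D. D tagged_division_of {a..b} \<and> (\<forall>(x, K)\<in>D. Sup K - Inf K < \<delta>) \<longrightarrow> P D)"
proof -
  define A where "A \<delta> = {D. D tagged_division_of {a..b} \<and> (\<forall>(x, K)\<in>D. Sup K - Inf K < \<delta>)}"
    for \<delta> :: real
  have "A (min \<delta> \<delta>') \<subseteq> A \<delta> \<inter> A \<delta>'" for \<delta> \<delta>'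
    unfolding A_def by fastforce
  then have "eventually P (INF \<delta>\<in>{0<..}. principal (A \<delta>)) \<longleftrightarrow>
      (\<exists>\<delta>\<in>{0<..}. eventually P (principal (A \<delta>)))"
    by (intro eventually_INF_base) (auto intro!: bexI[of _ "min _ _"])
  then show ?thesis
    by (auto simp: mesh_filter_def A_def eventually_principal)
qed

definition rs_sum ::
    "(real \<Rightarrow> 'w \<Rightarrow> real) \<Rightarrow> (real \<Rightarrow> real) \<Rightarrow> (real \<times> real set) set \<Rightarrow> 'w \<Rightarrow> real" where
  "rs_sum X h D \<omega> = (\<Sum>(x, K)\<in>D. h x * (X (Sup K) \<omega> - X (Inf K) \<omega>))"

definition has_stoch_integral ::
    "'w measure \<Rightarrow> (real \<Rightarrow> 'w \<Rightarrow> real) \<Rightarrow> real \<Rightarrow> real \<Rightarrow> (real \<Rightarrow> real) \<Rightarrow> ('w \<Rightarrow> real) \<Rightarrow> bool" where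
  "has_stoch_integral M X a b h J \<longleftrightarrow>
     J \<in> borel_measurable M \<and> tendsto_in_prob M (rs_sum X h) J (mesh_filter a b)"

text \<open>The limit is determined only almost surely; this picks a version of it.\<close>

definition stoch_integral ::
    "'w measure \<Rightarrow> (real \<Rightarrow> 'w \<Rightarrow> real) \<Rightarrow> real \<Rightarrow> real \<Rightarrow> (real \<Rightarrow> real) \<Rightarrow> 'w \<Rightarrow> real" where
  "stoch_integral M X a b h = (SOME J. has_stoch_integral M X a b h J)"

text \<open>
  The convention \<open>x\<^sup>0 = 1\<close> has to hold at \<open>x = 0\<close> as well, whereas \<open>0 powr 0 = 0\<close>; otherwise
  the weight would jump at an endpoint whose exponent is \<open>0\<close>.
\<close>

definition jacobi_weight :: "real \<Rightarrow> real \<Rightarrow> real \<Rightarrow> real" where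
  "jacobi_weight \<zeta> \<eta> v =
     (if \<zeta> = 0 then 1 else (1 - v) powr \<zeta>) * (if \<eta> = 0 then 1 else (1 + v) powr \<eta>)"

definition jacobi_measure :: "real \<Rightarrow> real \<Rightarrow> real measure" where
  "jacobi_measure \<zeta> \<eta> = density (lebesgue_on {-1..1}) (\<lambda>v. ennreal (jacobi_weight \<zeta> \<eta> v))"

definition Lp_jacobi :: "real \<Rightarrow> real \<Rightarrow> real \<Rightarrow> (real \<Rightarrow> real) set" where
  "Lp_jacobi p \<zeta> \<eta> = {g. g \<in> borel_measurable (jacobi_measure \<zeta> \<eta>) \<and>
     integrable (jacobi_measure \<zeta> \<eta>) (\<lambda>v. \<bar>g v\<bar> powr p)}"

definition jacobi_process ::
    "'w measure \<Rightarrow> (real \<Rightarrow> 'w \<Rightarrow> real) \<Rightarrow> real \<Rightarrow> real \<Rightarrow> real \<Rightarrow> 'w \<Rightarrow> real" where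
  "jacobi_process M X \<zeta> \<eta> v = stoch_integral M X (-1) v (jacobi_weight \<zeta> \<eta>)"

text \<open>
  For \<open>h\<close> continuous on \<open>[-1, 1]\<close> and \<open>Y = jacobi_process M X \<zeta> \<eta>\<close>, the integral of \<open>h\<close> against
  \<open>dY\<close> is by definition the integral of \<open>h\<close> times the weight against \<open>dX\<close>, as
  \<open>dY = jacobi_weight \<zeta> \<eta> dX\<close>.
\<close>

definition jacobi_process_integral ::
    "'w measure \<Rightarrow> (real \<Rightarrow> 'w \<Rightarrow> real) \<Rightarrow> real \<Rightarrow> real \<Rightarrow> (real \<Rightarrow> real) \<Rightarrow> 'w \<Rightarrow> real" where
  "jacobi_process_integral M X \<zeta> \<eta> h =
     stoch_integral M X (-1) 1 (\<lambda>v. h v * jacobi_weight \<zeta> \<eta> v)"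

lemma jacobi_process_integral_one:
  "jacobi_process_integral M X \<zeta> \<eta> (\<lambda>_. 1) = jacobi_process M X \<zeta> \<eta> 1"
  by (simp add: jacobi_process_integral_def jacobi_process_def)

end

theory Submission
  imports Defs
begin

text \<open>
  Let \<open>\<Delta>\<^sub>i = X (t (Suc i)) - X (t i)\<close> be increments of the process over a partition \<open>t\<close>. By
  independence, the characteristic function of \<open>\<Sum>i. c i * \<Delta>\<^sub>i\<close> is that of the scaled increment
  \<open>s powr (1 / \<alpha>) * (X 1 - X 0)\<close> with \<open>s = (\<Sum>i. \<bar>c i\<bar> powr \<alpha> * (t (Suc i) - t i))\<close>, so by
  uniqueness both have the same law, and the sum is small in probability as soon as \<open>s\<close> is small.
  Over a common refinement of two fine divisions this makes the Riemann-Stieltjes sums of a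
  continuous \<open>h\<close> Cauchy in probability, and it makes the integrals of \<open>h\<close> and \<open>h'\<close> close whenever
  the integral of \<open>\<bar>h - h'\<bar> powr \<alpha>\<close> is small. As the weight \<open>w\<close> is bounded and \<open>1 \<le> \<alpha> \<le> p\<close>, this
  integral for \<open>h = u * w\<close> and \<open>h' = v * w\<close> is controlled by the \<open>L\<^sup>p\<close> distance of \<open>u\<close> and \<open>v\<close>
  with respect to the Jacobi measure. Hence any two sequences approximating \<open>g\<close> have integrals
  that are jointly Cauchy in probability.
\<close>

section \<open>Convergence in probability\<close>

lemma tendsto_in_probD:
  assumes "tendsto_in_prob M Z J F" "0 < e" "0 < r"
  shows "eventually (\<lambda>i. measure M {\<omega> \<in> space M. \<bar>Z i \<omega> - J \<omega>\<bar> > e} < r) F"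
proof -
  have "((\<lambda>i. measure M {\<omega> \<in> space M. \<bar>Z i \<omega> - J \<omega>\<bar> > e}) \<longlongrightarrow> 0) F"
    using assms(1,2) unfolding tendsto_in_prob_def by blast
  then show ?thesis
    using order_tendstoD(2) assms(3) by fast
qed

context prob_space
begin

lemma prob_abs_diff_triangle:
  fixes U V W :: "'a \<Rightarrow> real"
  assumes [measurable]: "U \<in> borel_measurable M" "V \<in> borel_measurable M" "W \<in> borel_measurable M"
  shows "prob {\<omega> \<in> space M. \<bar>U \<omega> - W \<omega>\<bar> > e} \<le>
    prob {\<omega> \<in> space M. \<bar>U \<omega> - V \<omega>\<bar> > e / 2} + prob {\<omega> \<in> space M. \<bar>V \<omega> - W \<omega>\<bar> > e / 2}"
proof -
  let ?A = "{\<omega> \<in> space M. \<bar>U \<omega> - V \<omega>\<bar> > e / 2}" and ?B = "{\<omega> \<in> space M. \<bar>V \<omega> - W \<omega>\<bar> > e / 2}"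
  have "prob {\<omega> \<in> space M. \<bar>U \<omega> - W \<omega>\<bar> > e} \<le> prob (?A \<union> ?B)"
  proof (intro finite_measure_mono subsetI)
    fix \<omega> assume "\<omega> \<in> {\<omega> \<in> space M. \<bar>U \<omega> - W \<omega>\<bar> > e}"
    moreover have "\<bar>U \<omega> - W \<omega>\<bar> \<le> \<bar>U \<omega> - V \<omega>\<bar> + \<bar>V \<omega> - W \<omega>\<bar>"
      by linarith
    ultimately show "\<omega> \<in> ?A \<union> ?B"
      by auto
  qed measurable
  also have "\<dots> \<le> prob ?A + prob ?B"
    by (intro measure_Un_le) auto
  finally show ?thesis .
qed

text \<open>Almost everywhere the indicators of the exceptional events are eventually 0, and the
  constant 1 dominates them, so dominated convergence sends their integrals, which are the
  probabilities, to 0.\<close>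

lemma tendsto_in_prob_AE:
  fixes Z :: "nat \<Rightarrow> 'a \<Rightarrow> real"
  assumes [measurable]: "\<And>n. Z n \<in> borel_measurable M" "J \<in> borel_measurable M"
    and lim: "AE \<omega> in M. (\<lambda>n. Z n \<omega>) \<longlonglongrightarrow> J \<omega>"
  shows "tendsto_in_prob M Z J sequentially"
  unfolding tendsto_in_prob_def
proof (intro allI impI)
  fix e :: real assume "e > 0"
  let ?A = "\<lambda>n. {\<omega> \<in> space M. \<bar>Z n \<omega> - J \<omega>\<bar> > e}"
  have "(\<lambda>n. \<integral>\<omega>. indicat_real (?A n) \<omega> \<partial>M) \<longlonglongrightarrow> (\<integral>\<omega>. 0 \<partial>M)"
  proof (rule integral_dominated_convergence[where w = "\<lambda>_. 1"])
    show "AE \<omega> in M. (\<lambda>n. indicat_real (?A n) \<omega>) \<longlonglongrightarrow> 0"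
      using lim
    proof eventually_elim
      case (elim \<omega>)
      then have "eventually (\<lambda>n. \<bar>Z n \<omega> - J \<omega>\<bar> < e) sequentially"
        using \<open>e > 0\<close> by (auto simp: tendsto_iff dist_real_def)
      then show ?case
        by (intro tendsto_eventually) (auto elim!: eventually_mono simp: indicator_def)
    qed
  qed (auto simp: indicator_def)
  then show "(\<lambda>n. prob (?A n)) \<longlonglongrightarrow> 0"
    by simp
qed

text \<open>The triangle bound for \<open>J'\<close>, \<open>Z i\<close>, \<open>J\<close> tends to
  0 along the nontrivial filter \<open>F\<close>, so each event
  \<open>\<bar>J' \<omega> - J \<omega>\<bar> > e\<close> is null. The countably many thresholds
  \<open>1 / Suc n\<close> then exhaust the event that \<open>J'\<close> and \<open>J\<close>
  differ.\<close>

lemma tendsto_in_prob_unique: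
  fixes Z :: "'i \<Rightarrow> 'a \<Rightarrow> real"
  assumes F: "F \<noteq> bot" and meas: "eventually (\<lambda>i. Z i \<in> borel_measurable M) F"
    and [measurable]: "J \<in> borel_measurable M" "J' \<in> borel_measurable M"
    and J: "tendsto_in_prob M Z J F" and J': "tendsto_in_prob M Z J' F"
  shows "AE \<omega> in M. J' \<omega> = J \<omega>"
proof -
  have zero: "prob {\<omega> \<in> space M. \<bar>J' \<omega> - J \<omega>\<bar> > e} = 0" if "e > 0" for e
  proof -
    have lim: "((\<lambda>i. prob {\<omega> \<in> space M. \<bar>Z i \<omega> - J' \<omega>\<bar> > e / 2} +
        prob {\<omega> \<in> space M. \<bar>Z i \<omega> - J \<omega>\<bar> > e / 2}) \<longlongrightarrow> 0 + 0) F"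
      using J J' half_gt_zero[OF that] unfolding tendsto_in_prob_def by (intro tendsto_add) blast+
    have "eventually (\<lambda>i. prob {\<omega> \<in> space M. \<bar>J' \<omega> - J \<omega>\<bar> > e} \<le>
        prob {\<omega> \<in> space M. \<bar>Z i \<omega> - J' \<omega>\<bar> > e / 2} +
        prob {\<omega> \<in> space M. \<bar>Z i \<omega> - J \<omega>\<bar> > e / 2}) F"
      using meas
    proof eventually_elim
      case (elim i)
      from prob_abs_diff_triangle[OF assms(4) elim assms(3), of e] show ?case
        by (simp add: abs_minus_commute)
    qed
    with lim have "prob {\<omega> \<in> space M. \<bar>J' \<omega> - J \<omega>\<bar> > e} \<le> 0 + 0"
      by (intro tendsto_lowerbound[OF _ _ F])
    then show ?thesis
      by (simp add: measure_le_0_iff)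
  qed
  have "AE \<omega> in M. \<forall>n::nat. \<not> \<bar>J' \<omega> - J \<omega>\<bar> > 1 / Suc n"
    unfolding AE_all_countable
  proof
    fix n :: nat
    show "AE \<omega> in M. \<not> \<bar>J' \<omega> - J \<omega>\<bar> > 1 / Suc n"
      using zero[of "1 / Suc n"] by (subst AE_iff_measurable[OF _ refl]) (auto simp: emeasure_eq_measure)
  qed
  then show ?thesis
  proof eventually_elim
    case (elim \<omega>)
    then show ?case
      by (metis eq_iff_diff_eq_0 nat_approx_posE zero_less_abs_iff)
  qed
qed

text \<open>Completeness along an arbitrary filter, so that it serves both sequences and the mesh
  filter. A rapidly Cauchy sequence of indices converges almost surely by Borel-Cantelli, and the
  Cauchy property carries its limit over to the whole filter.\<close>

lemma Cauchy_in_prob_convergent: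
  fixes Z :: "'i \<Rightarrow> 'a \<Rightarrow> real"
  assumes F: "F \<noteq> bot" and meas: "eventually (\<lambda>i. Z i \<in> borel_measurable M) F"
    and Cauchy: "\<And>e r. e > 0 \<Longrightarrow> r > 0 \<Longrightarrow>
      eventually (\<lambda>(i, j). prob {\<omega> \<in> space M. \<bar>Z i \<omega> - Z j \<omega>\<bar> > e} < r) (F \<times>\<^sub>F F)"
  shows "\<exists>J \<in> borel_measurable M. tendsto_in_prob M Z J F"
proof -
  \<comment> \<open>The same \<open>(1/2)^n\<close> bounds distance and probability: summable
    probabilities feed Borel-Cantelli, summable distances make the increments absolutely
    summable.\<close>
  have *: "\<forall>n::nat. \<exists>Q. eventually Q F \<and> (\<forall>i. Q i \<longrightarrow> Z i \<in> borel_measurable M) \<and>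
      (\<forall>i j. Q i \<longrightarrow> Q j \<longrightarrow> prob {\<omega> \<in> space M. \<bar>Z i \<omega> - Z j \<omega>\<bar> > (1/2)^n} < (1/2)^n)"
  proof
    fix n :: nat
    obtain Q where Q: "eventually Q F"
        "\<forall>i j. Q i \<longrightarrow> Q j \<longrightarrow> prob {\<omega> \<in> space M. \<bar>Z i \<omega> - Z j \<omega>\<bar> > (1/2)^n} < (1/2)^n"
      using Cauchy[of "(1/2)^n" "(1/2)^n"] unfolding eventually_prod_same by auto
    then show "\<exists>Q. eventually Q F \<and> (\<forall>i. Q i \<longrightarrow> Z i \<in> borel_measurable M) \<and>
      (\<forall>i j. Q i \<longrightarrow> Q j \<longrightarrow> prob {\<omega> \<in> space M. \<bar>Z i \<omega> - Z j \<omega>\<bar> > (1/2)^n} < (1/2)^n)"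
      using meas by (intro exI[of _ "\<lambda>i. Q i \<and> Z i \<in> borel_measurable M"]) (auto intro: eventually_conj)
  qed
  from choice[OF *] obtain Q where Q: "\<And>n. eventually (Q n) F" "\<And>n i. Q n i \<Longrightarrow> Z i \<in> borel_measurable M"
    "\<And>n i j. Q n i \<Longrightarrow> Q n j \<Longrightarrow> prob {\<omega> \<in> space M. \<bar>Z i \<omega> - Z j \<omega>\<bar> > (1/2)^n} < (1/2)^n"
    by blast
  \<comment> \<open>Finitely many eventual properties hold together at some index. Hence
    \<open>x n\<close> satisfies all of \<open>Q 0, ..., Q n\<close>, and \<open>x n\<close>,
    \<open>x (Suc n)\<close> both satisfy \<open>Q n\<close>.\<close>
  have "\<exists>i. \<forall>k\<in>{..n}. Q k i" for n
    by (rule eventually_happens'[OF F]) (auto simp: eventually_ball_finite Q(1))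
  then obtain x where x: "\<And>k n. k \<le> n \<Longrightarrow> Q k (x n)"
    by (metis atMost_iff)
  have [measurable]: "Z (x n) \<in> borel_measurable M" for n
    using Q(2) x by blast
  \<comment> \<open>Where the sequence diverges, \<open>lim\<close> has an unspecified value; this
    concerns only a null set.\<close>
  define J where "J \<omega> = lim (\<lambda>n. Z (x n) \<omega>)" for \<omega>
  have [measurable]: "J \<in> borel_measurable M"
    unfolding J_def by measurable
  have "AE \<omega> in M. eventually (\<lambda>n. \<omega> \<in> space M -
      {\<omega> \<in> space M. \<bar>Z (x (Suc n)) \<omega> - Z (x n) \<omega>\<bar> > (1/2)^n}) sequentially"
  proof (rule borel_cantelli_AE1)
    have "prob {\<omega> \<in> space M. \<bar>Z (x (Suc n)) \<omega> - Z (x n) \<omega>\<bar> > (1/2)^n} \<le> (1/2)^n" for n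
      using Q(3)[of n "x (Suc n)" "x n"] x[of n] by simp
    then show "summable (\<lambda>n. prob {\<omega> \<in> space M. \<bar>Z (x (Suc n)) \<omega> - Z (x n) \<omega>\<bar> > (1/2)^n})"
      by (intro summable_comparison_test'[OF summable_geometric[of "1/2::real"]]) auto
  qed (auto simp: emeasure_eq_measure)
  then have "AE \<omega> in M. (\<lambda>n. Z (x n) \<omega>) \<longlonglongrightarrow> J \<omega>"
  proof eventually_elim
    case (elim \<omega>)
    then have "summable (\<lambda>n. Z (x (Suc n)) \<omega> - Z (x n) \<omega>)"
      by (intro summable_comparison_test_ev[OF _ summable_geometric[of "1/2::real"]])
        (auto elim!: eventually_mono)
    then have "convergent (\<lambda>n. (\<Sum>k<n. Z (x (Suc k)) \<omega> - Z (x k) \<omega>) + Z (x 0) \<omega>)"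
      by (intro convergent_add convergent_const) (simp add: summable_iff_convergent)
    then have "convergent (\<lambda>n. Z (x n) \<omega>)"
      by (simp add: sum_lessThan_telescope[of "\<lambda>k. Z (x k) \<omega>"])
    then show ?case
      unfolding J_def by (simp add: convergent_LIMSEQ_iff)
  qed
  then have sub: "tendsto_in_prob M (\<lambda>n. Z (x n)) J sequentially"
    by (intro tendsto_in_prob_AE) auto
  have "tendsto_in_prob M Z J F"
    unfolding tendsto_in_prob_def
  proof (intro allI impI)
    fix e :: real assume "e > 0"
    show "((\<lambda>i. prob {\<omega> \<in> space M. \<bar>Z i \<omega> - J \<omega>\<bar> > e}) \<longlongrightarrow> 0) F"
    proof (rule tendstoI)
      fix r :: real assume "r > 0"
      \<comment> \<open>Any \<open>i\<close> with \<open>Q N i\<close> is then within the tolerances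
        \<open>e/2\<close>, \<open>r/2\<close> of \<open>x n\<close> for every
        \<open>n \<ge> N\<close>; a large such \<open>n\<close> brings \<open>x n\<close> close to
        \<open>J\<close>.\<close>
      obtain N where N: "(1/2)^N < min (e/2) (r/2)"
        using \<open>e > 0\<close> \<open>r > 0\<close> real_arch_pow_inv[of "min (e/2) (r/2)" "1/2"] by auto
      have "eventually (\<lambda>n. prob {\<omega> \<in> space M. \<bar>Z (x n) \<omega> - J \<omega>\<bar> > e/2} < r/2) sequentially"
        using tendsto_in_probD[OF sub half_gt_zero[OF \<open>e > 0\<close>] half_gt_zero[OF \<open>r > 0\<close>]] .
      then obtain n where n: "n \<ge> N" "prob {\<omega> \<in> space M. \<bar>Z (x n) \<omega> - J \<omega>\<bar> > e/2} < r/2"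
        unfolding eventually_sequentially by (meson linorder_linear order_refl)
      show "eventually (\<lambda>i. dist (prob {\<omega> \<in> space M. \<bar>Z i \<omega> - J \<omega>\<bar> > e}) 0 < r) F"
        using Q(1)[of N]
      proof eventually_elim
        case (elim i)
        note [measurable] = Q(2)[OF elim]
        have "prob {\<omega> \<in> space M. \<bar>Z i \<omega> - Z (x n) \<omega>\<bar> > e/2} \<le>
            prob {\<omega> \<in> space M. \<bar>Z i \<omega> - Z (x n) \<omega>\<bar> > (1/2)^N}"
          using N by (intro finite_measure_mono) auto
        also have "\<dots> < r/2"
          using Q(3)[OF elim x[OF n(1)]] N by simp
        finally show ?case
          using prob_abs_diff_triangle[of "Z i" "Z (x n)" J e] n(2) by simp
      qed
    qed
  qed
  then show ?thesis
    by auto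
qed

end

section \<open>Tagged divisions\<close>

lemma finite_set_strict_mono_enum:
  fixes P :: "real set"
  assumes "finite P" "P \<noteq> {}"
  obtains n and t :: "nat \<Rightarrow> real" where "strict_mono_on {..n} t" "t ` {..n} = P"
proof -
  define xs where "xs = sorted_list_of_set P"
  have xs: "set xs = P" "sorted_wrt (<) xs" "xs \<noteq> []"
    using assms by (auto simp: xs_def)
  show thesis
  proof
    have "{..length xs - 1} = {..<length xs}"
      using xs(3) by (cases xs) auto
    then show "strict_mono_on {..length xs - 1} (\<lambda>i. xs ! i)" "(\<lambda>i. xs ! i) ` {..length xs - 1} = P"
      using xs by (auto simp: strict_mono_on_def sorted_wrt_iff_nth_less set_conv_nth)
  qed
qed

text \<open>On an interval \<open>{u..v}\<close> with no endpoint of \<open>D\<close> in its interior, the sum has a single term.\<close>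

definition step_value :: "(real \<Rightarrow> real) \<Rightarrow> (real \<times> real set) set \<Rightarrow> real \<Rightarrow> real \<Rightarrow> real" where
  "step_value h D u v = (\<Sum>(x, K) | (x, K) \<in> D \<and> Inf K \<le> u \<and> v \<le> Sup K. h x)"

definition division_endpoints :: "(real \<times> real set) set \<Rightarrow> real set" where
  "division_endpoints D = (\<lambda>(x, K). Inf K) ` D \<union> (\<lambda>(x, K). Sup K) ` D"

text \<open>The tag lies in \<open>K\<close>, so the box is nonempty and its corners are
  \<open>Inf K\<close> and \<open>Sup K\<close>. Single points remain possible.\<close>

lemma tagged_division_interval:
  fixes a b :: real
  assumes "D tagged_division_of {a..b}" "(x, K) \<in> D"
  shows "K = {Inf K..Sup K}" "Inf K \<le> x" "x \<le> Sup K" "a \<le> Inf K" "Sup K \<le> b"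
proof -
  obtain c d where K: "K = cbox c d" "x \<in> K" "K \<subseteq> {a..b}"
    using tagged_division_ofD(2,3,4)[OF assms] by auto
  then have "c \<le> d" by auto
  with K show "K = {Inf K..Sup K}" "Inf K \<le> x" "x \<le> Sup K" "a \<le> Inf K" "Sup K \<le> b"
    by auto
qed

lemma division_endpoints_subset:
  assumes "D tagged_division_of {a..b}"
  shows "finite (division_endpoints D)" "division_endpoints D \<subseteq> {a..b}"
proof -
  show "finite (division_endpoints D)"
    using assms unfolding division_endpoints_def by auto
  show "division_endpoints D \<subseteq> {a..b}"
    unfolding division_endpoints_def
    using tagged_division_interval[OF assms] by (fastforce intro: order_trans)
qed

text \<open>The midpoint of \<open>{u..v}\<close> lies in some member of \<open>D\<close>, which
  must reach over all of \<open>{u..v}\<close> because no endpoint falls strictly inside. The same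
  tag \<open>x\<close> works for every \<open>h\<close>, so \<open>step_value\<close> commutes with
  applying a function to the values of \<open>h\<close>.\<close>

lemma step_value_eq:
  fixes a b :: real
  assumes D: "D tagged_division_of {a..b}" and uv: "u < v" "a \<le> u" "v \<le> b"
    and P: "division_endpoints D \<inter> {u<..<v} = {}"
  obtains x K where "(x, K) \<in> D" "Inf K \<le> u" "v \<le> Sup K" "\<And>h. step_value h D u v = h x"
proof -
  have ends: "Inf K \<notin> {u<..<v}" "Sup K \<notin> {u<..<v}" if "(x, K) \<in> D" for x K
    using P that unfolding division_endpoints_def by force+
  have "(u + v) / 2 \<in> {a..b}"
    using uv by auto
  then obtain x K where K: "(x, K) \<in> D" "(u + v) / 2 \<in> K"
    using tagged_division_ofD(6)[OF D] by blast
  have "Inf K \<le> (u + v) / 2" "(u + v) / 2 \<le> Sup K"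
    using K(2) tagged_division_interval(1)[OF D K(1)] by (metis atLeastAtMost_iff)+
  with ends[OF K(1)] uv have le: "Inf K \<le> u" "v \<le> Sup K"
    by auto
  \<comment> \<open>Members reaching over \<open>{u..v}\<close> share an interior point, and
    distinct members have disjoint interiors; so only one such member exists.\<close>
  have int: "(u + v) / 2 \<in> interior L" if "(y, L) \<in> D" "Inf L \<le> u" "v \<le> Sup L" for y L
    by (subst tagged_division_interval(1)[OF D that(1)]) (use uv that in auto)
  have "{(y, L). (y, L) \<in> D \<and> Inf L \<le> u \<and> v \<le> Sup L} = {(x, K)}"
    using tagged_division_ofD(5)[OF D] K(1) le int by blast
  then have "step_value h D u v = h x" for h
    unfolding step_value_def by simp
  with K(1) le show thesis
    by (intro that)
qed

text \<open>Each increment of \<open>Y\<close> over a member of \<open>D\<close> telescopes over the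
  points of \<open>t\<close> inside it; exchanging the two sums collects the coefficients of each
  small increment. Since \<open>Y\<close> is arbitrary, this covers the process and also the
  identity path, whose sums are ordinary Riemann sums.\<close>

lemma rs_sum_eq_sum_step_value:
  fixes Y :: "real \<Rightarrow> 'w \<Rightarrow> real" and t :: "nat \<Rightarrow> real"
  assumes D: "D tagged_division_of {a..b}"
    and t: "strict_mono_on {..n} t" and ends: "division_endpoints D \<subseteq> t ` {..n}"
  shows "rs_sum Y h D \<omega> = (\<Sum>i<n. step_value h D (t i) (t (Suc i)) * (Y (t (Suc i)) \<omega> - Y (t i) \<omega>))"
proof -
  have fin: "finite D" using D by auto
  have tele: "Y (Sup K) \<omega> - Y (Inf K) \<omega> =
      (\<Sum>i | i < n \<and> Inf K \<le> t i \<and> t (Suc i) \<le> Sup K. Y (t (Suc i)) \<omega> - Y (t i) \<omega>)"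
    if "(x, K) \<in> D" for x K
  proof -
    have "Inf K \<in> t ` {..n}" "Sup K \<in> t ` {..n}"
      using ends that unfolding division_endpoints_def by force+
    then obtain j k where jk: "j \<le> n" "k \<le> n" "Inf K = t j" "Sup K = t k"
      by auto
    have le_iff: "t i \<le> t i' \<longleftrightarrow> i \<le> i'" if "i \<le> n" "i' \<le> n" for i i'
      using strict_mono_on_less_eq[OF t] that by simp
    have "j \<le> k"
      using tagged_division_interval(2,3)[OF D that] le_iff jk by (metis order_trans)
    have "{i. i < n \<and> Inf K \<le> t i \<and> t (Suc i) \<le> Sup K} = {j..<k}"
      using jk by (auto simp: le_iff)
    then show ?thesis
      using sum_Suc_diff'[OF \<open>j \<le> k\<close>, of "\<lambda>i. Y (t i) \<omega>"] jk by simp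
  qed
  have "rs_sum Y h D \<omega> = (\<Sum>(x, K)\<in>D. \<Sum>i | i < n \<and> Inf K \<le> t i \<and> t (Suc i) \<le> Sup K.
      h x * (Y (t (Suc i)) \<omega> - Y (t i) \<omega>))"
    unfolding rs_sum_def by (intro sum.cong) (auto simp: tele sum_distrib_left)
  also have "\<dots> = (\<Sum>z\<in>D. \<Sum>i\<in>{..<n}. if Inf (snd z) \<le> t i \<and> t (Suc i) \<le> Sup (snd z)
      then h (fst z) * (Y (t (Suc i)) \<omega> - Y (t i) \<omega>) else 0)"
    by (intro sum.cong) (auto simp: sum.inter_filter[symmetric] case_prod_unfold intro!: sum.cong)
  also have "\<dots> = (\<Sum>i<n. \<Sum>z\<in>D. if Inf (snd z) \<le> t i \<and> t (Suc i) \<le> Sup (snd z)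
      then h (fst z) * (Y (t (Suc i)) \<omega> - Y (t i) \<omega>) else 0)"
    by (rule sum.swap)
  also have "\<dots> = (\<Sum>i<n. step_value h D (t i) (t (Suc i)) * (Y (t (Suc i)) \<omega> - Y (t i) \<omega>))"
    unfolding step_value_def using fin
    by (intro sum.cong) (auto simp: sum.inter_filter[symmetric] sum_distrib_right case_prod_unfold intro!: sum.cong)
  finally show ?thesis .
qed

lemma strict_mono_on_consecutive:
  fixes t :: "nat \<Rightarrow> real"
  assumes t: "strict_mono_on {..n} t" and i: "i < n"
  shows "t i < t (Suc i)" "t ` {..n} \<inter> {t i<..<t (Suc i)} = {}"
proof -
  show "t i < t (Suc i)"
    using t i by (auto simp: strict_mono_on_def)
  have "\<not> (t i < t j \<and> t j < t (Suc i))" if "j \<le> n" for j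
    using strict_mono_on_less[OF t] that i by (auto simp: less_Suc_eq_le)
  then show "t ` {..n} \<inter> {t i<..<t (Suc i)} = {}"
    by auto
qed

text \<open>\<open>t\<close> enumerates the union of both endpoint sets, which is nonempty because
  \<open>{a..b}\<close> is. With \<open>D' = D\<close> it enumerates the endpoints of a single
  division.\<close>

lemma common_refinement:
  fixes a b :: real
  assumes "a \<le> b" "D tagged_division_of {a..b}" "D' tagged_division_of {a..b}"
  obtains n and t :: "nat \<Rightarrow> real" where "strict_mono_on {..n} t" "t ` {..n} \<subseteq> {a..b}"
    "division_endpoints D \<subseteq> t ` {..n}" "division_endpoints D' \<subseteq> t ` {..n}"
proof -
  have "D \<noteq> {}"
    using tagged_division_ofD(6)[OF assms(2)] \<open>a \<le> b\<close> by force
  then have ne: "division_endpoints D \<union> division_endpoints D' \<noteq> {}"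
    unfolding division_endpoints_def by auto
  have fin: "finite (division_endpoints D \<union> division_endpoints D')"
    using division_endpoints_subset(1)[OF assms(2)] division_endpoints_subset(1)[OF assms(3)] by simp
  obtain n and t :: "nat \<Rightarrow> real" where
      "strict_mono_on {..n} t" "t ` {..n} = division_endpoints D \<union> division_endpoints D'"
    by (rule finite_set_strict_mono_enum[OF fin ne])
  then show thesis
    using division_endpoints_subset[OF assms(2)] division_endpoints_subset[OF assms(3)]
    by (intro that) auto
qed

section \<open>Riemann sums over divisions of small mesh\<close>

text \<open>Links gauges to the mesh: the radius is \<open>\<delta> / 2\<close> because an interval
  may extend to both sides of its tag.\<close>

lemma ball_fine_imp_mesh_less:
  fixes a b :: real
  assumes D: "D tagged_division_of {a..b}" and fine: "(\<lambda>x. ball x (\<delta> / 2)) fine D"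
  shows "\<forall>(x, K)\<in>D. Sup K - Inf K < \<delta>"
proof clarify
  fix x K assume K: "(x, K) \<in> D"
  note I = tagged_division_interval[OF D K]
  have "Inf K \<in> {Inf K..Sup K}" "Sup K \<in> {Inf K..Sup K}"
    using I(2,3) by auto
  moreover have "{Inf K..Sup K} \<subseteq> ball x (\<delta> / 2)"
    using fine K I(1) unfolding fine_def by auto
  ultimately have "Inf K \<in> ball x (\<delta> / 2)" "Sup K \<in> ball x (\<delta> / 2)"
    by blast+
  then have "\<bar>x - Inf K\<bar> < \<delta> / 2" "\<bar>x - Sup K\<bar> < \<delta> / 2"
    by (simp_all add: dist_real_def)
  then show "Sup K - Inf K < \<delta>"
    by linarith
qed

text \<open>Intersecting the gauge of the integral with balls of constant radius gives a gauge
  again. A division fine for it has small mesh, hence satisfies \<open>P\<close>, and also has a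
  Riemann sum close to \<open>I\<close>.\<close>

lemma mesh_filter_riemann_sum:
  fixes a b :: real
  assumes f: "(f has_integral I) {a..b}" and "0 < e" and ev: "eventually P (mesh_filter a b)"
  obtains D where "D tagged_division_of {a..b}" "P D"
    "\<bar>(\<Sum>(x, K)\<in>D. f x * (Sup K - Inf K)) - I\<bar> < e"
proof -
  obtain \<gamma> where \<gamma>: "gauge \<gamma>" "\<And>D. D tagged_division_of {a..b} \<Longrightarrow> \<gamma> fine D \<Longrightarrow>
      norm ((\<Sum>(x, K)\<in>D. measure lborel K *\<^sub>R f x) - I) < e"
    by (rule has_integralD[OF f[folded box_real(2)] \<open>0 < e\<close>]) (unfold box_real, blast)
  obtain \<delta> where \<delta>: "0 < \<delta>"
      "\<And>D. D tagged_division_of {a..b} \<Longrightarrow> \<forall>(x, K)\<in>D. Sup K - Inf K < \<delta> \<Longrightarrow> P D"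
    using ev unfolding eventually_mesh_filter by blast
  have "gauge (\<lambda>x. ball x (\<delta> / 2) \<inter> \<gamma> x)"
    using \<gamma>(1) \<delta>(1) by (intro gauge_Int gauge_ball_dependent) auto
  then obtain D where D: "D tagged_division_of {a..b}" "(\<lambda>x. ball x (\<delta> / 2) \<inter> \<gamma> x) fine D"
    by (rule fine_division_exists_real)
  then have fine: "(\<lambda>x. ball x (\<delta> / 2)) fine D" "\<gamma> fine D"
    by (simp_all add: fine_Int)
  have "(\<Sum>(x, K)\<in>D. f x * (Sup K - Inf K)) = (\<Sum>(x, K)\<in>D. measure lborel K *\<^sub>R f x)"
  proof (intro sum.cong refl, clarify)
    fix x K assume "(x, K) \<in> D"
    from tagged_division_interval[OF D(1) this]
    have "measure lborel K = Sup K - Inf K"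
      by (metis content_real order_trans)
    then show "f x * (Sup K - Inf K) = measure lborel K *\<^sub>R f x"
      by simp
  qed
  with \<gamma>(2)[OF D(1) fine(2)] \<delta>(2)[OF D(1) ball_fine_imp_mesh_less[OF D(1) fine(1)]] D(1)
  show thesis
    by (intro that) auto
qed

text \<open>Applied to the zero function, the previous lemma produces a division satisfying any
  eventual property, so \<open>False\<close> cannot be one.\<close>

lemma mesh_filter_neq_bot: "mesh_filter a b \<noteq> bot"
proof
  assume "mesh_filter a b = bot"
  then have "eventually (\<lambda>_. False) (mesh_filter a b)"
    by simp
  then show False
    by (rule mesh_filter_riemann_sum[OF has_integral_0 zero_less_one])
qed

lemma rs_sum_diff: "rs_sum X h D \<omega> - rs_sum X h' D \<omega> = rs_sum X (\<lambda>x. h x - h' x) D \<omega>"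
  unfolding rs_sum_def case_prod_unfold by (simp add: left_diff_distrib sum_subtractf)

section \<open>Laws of increment sums and the stochastic integral\<close>

context symmetric_stable_process
begin

lemma rs_sum_measurable [measurable]: "rs_sum X h D \<in> borel_measurable M"
  unfolding rs_sum_def case_prod_unfold using random_variable_X by measurable

text \<open>With \<open>K\<close> the constant of the process, independence gives the product of
  \<open>exp (- K * (t (Suc i) - t i) * \<bar>\<theta> * c i\<bar> powr \<alpha>)\<close> as
  characteristic function. The exponents add up to
  \<open>- K * \<bar>\<theta>\<bar> powr \<alpha> * s\<close>.\<close>

lemma distr_increment_sum:
  fixes t c :: "nat \<Rightarrow> real"
  assumes \<alpha>: "0 < \<alpha>" and t: "mono_on {..n} t"
    and s: "s = (\<Sum>i<n. \<bar>c i\<bar> powr \<alpha> * (t (Suc i) - t i))"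
  shows "distr M borel (\<lambda>\<omega>. \<Sum>i<n. c i * (X (t (Suc i)) \<omega> - X (t i) \<omega>)) =
    distr M borel (\<lambda>\<omega>. s powr (1 / \<alpha>) * (X 1 \<omega> - X 0 \<omega>))"
proof (rule Levy_uniqueness)
  note [measurable] = random_variable_X
  show "real_distribution (distr M borel (\<lambda>\<omega>. \<Sum>i<n. c i * (X (t (Suc i)) \<omega> - X (t i) \<omega>)))"
    "real_distribution (distr M borel (\<lambda>\<omega>. s powr (1 / \<alpha>) * (X 1 \<omega> - X 0 \<omega>)))"
    by (intro real_distribution_distr; measurable)+
  obtain K where K: "\<And>\<theta> v w. (CLINT \<omega>|M. iexp (\<theta> * (X v \<omega> - X w \<omega>))) =
      complex_of_real (exp (- K * \<bar>v - w\<bar> * \<bar>\<theta>\<bar> powr \<alpha>))"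
    using char_increments by blast
  have char_scaled: "char (distr M borel (\<lambda>\<omega>. d * (X v \<omega> - X w \<omega>))) \<theta> =
      complex_of_real (exp (- K * \<bar>v - w\<bar> * \<bar>\<theta> * d\<bar> powr \<alpha>))" for d v w \<theta>
    unfolding char_def using K[of "\<theta> * d" v w] by (subst integral_distr) (auto simp: mult.assoc)
  have le: "t i \<le> t (Suc i)" if "i < n" for i
    using t that by (auto simp: mono_on_def)
  have "s \<ge> 0"
    unfolding s using le by (intro sum_nonneg mult_nonneg_nonneg) auto
  have indep: "indep_vars (\<lambda>_. borel) (\<lambda>i \<omega>. c i * (X (t (Suc i)) \<omega> - X (t i) \<omega>)) {..<n}"
    using indep_vars_compose2[OF independent_increments[OF t], of "\<lambda>i x. c i * x" "\<lambda>_. borel"] by simp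
  show "char (distr M borel (\<lambda>\<omega>. \<Sum>i<n. c i * (X (t (Suc i)) \<omega> - X (t i) \<omega>))) =
      char (distr M borel (\<lambda>\<omega>. s powr (1 / \<alpha>) * (X 1 \<omega> - X 0 \<omega>)))"
  proof
    fix \<theta>
    have "char (distr M borel (\<lambda>\<omega>. \<Sum>i<n. c i * (X (t (Suc i)) \<omega> - X (t i) \<omega>))) \<theta> =
        (\<Prod>i<n. complex_of_real (exp (- K * \<bar>t (Suc i) - t i\<bar> * \<bar>\<theta> * c i\<bar> powr \<alpha>)))"
      by (simp add: char_distr_sum[OF indep] char_scaled)
    also have "\<dots> = complex_of_real (exp (\<Sum>i<n. - K * \<bar>t (Suc i) - t i\<bar> * \<bar>\<theta> * c i\<bar> powr \<alpha>))"
      by (simp add: exp_sum)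
    also have "(\<Sum>i<n. - K * \<bar>t (Suc i) - t i\<bar> * \<bar>\<theta> * c i\<bar> powr \<alpha>) = - K * \<bar>\<theta>\<bar> powr \<alpha> * s"
      unfolding s sum_distrib_left using le by (intro sum.cong) (auto simp: abs_mult powr_mult)
    \<comment> \<open>The factor \<open>\<bar>1 - 0\<bar>\<close> is left unsimplified to match
      \<open>char_scaled\<close> for the increment from 0 to 1.\<close>
    also have "\<dots> = - K * \<bar>1 - 0\<bar> * \<bar>\<theta> * s powr (1 / \<alpha>)\<bar> powr \<alpha>"
      using \<open>s \<ge> 0\<close> \<alpha> by (simp add: abs_mult powr_mult powr_powr)
    finally show "char (distr M borel (\<lambda>\<omega>. \<Sum>i<n. c i * (X (t (Suc i)) \<omega> - X (t i) \<omega>))) \<theta> =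
        char (distr M borel (\<lambda>\<omega>. s powr (1 / \<alpha>) * (X 1 \<omega> - X 0 \<omega>))) \<theta>"
      by (simp only: char_scaled)
  qed
qed

text \<open>The law depends on \<open>n\<close>, \<open>t\<close>, \<open>c\<close> only through
  \<open>s\<close>, so one \<open>d\<close> serves all partitions and coefficients: the tail of the
  single variable \<open>X 1 - X 0\<close> decides.\<close>

lemma prob_increment_sum_small:
  assumes \<alpha>: "0 < \<alpha>" and "0 < e" "0 < r"
  obtains d where "0 < d"
    "\<And>n t c. mono_on {..n} t \<Longrightarrow> (\<Sum>i<n. \<bar>c i\<bar> powr \<alpha> * (t (Suc i) - t i)) < d \<Longrightarrow>
      prob {\<omega> \<in> space M. \<bar>\<Sum>i<n. c i * (X (t (Suc i)) \<omega> - X (t i) \<omega>)\<bar> > e} < r"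
proof -
  note [measurable] = random_variable_X
  let ?W = "\<lambda>\<omega>. X 1 \<omega> - X 0 \<omega>"
  \<comment> \<open>Tightness of one random variable: \<open>?W / Suc k\<close> tends to 0
    pointwise, so some level \<open>N\<close> is exceeded with probability below
    \<open>r\<close>.\<close>
  have "tendsto_in_prob M (\<lambda>k \<omega>. ?W \<omega> / real (Suc k)) (\<lambda>_. 0) sequentially"
    by (intro tendsto_in_prob_AE AE_I2 LIMSEQ_Suc lim_const_over_n) measurable
  then have "eventually (\<lambda>k. prob {\<omega> \<in> space M. \<bar>?W \<omega> / real (Suc k) - 0\<bar> > 1} < r) sequentially"
    using \<open>0 < r\<close> by (rule tendsto_in_probD[OF _ zero_less_one])
  then obtain k where "prob {\<omega> \<in> space M. \<bar>?W \<omega> / real (Suc k) - 0\<bar> > 1} < r"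
    unfolding eventually_sequentially by blast
  moreover define N where "N = real (Suc k)"
  ultimately have N: "N > 0" "prob {\<omega> \<in> space M. \<bar>?W \<omega>\<bar> > N} < r"
    by (auto simp: field_simps simp del: of_nat_Suc)
  show thesis
  proof
    \<comment> \<open>The threshold is chosen so that \<open>s\<close> below it gives
      \<open>s powr (1 / \<alpha>) * N \<le> e\<close>; the scaled increment can then exceed
      \<open>e\<close> only where \<open>?W\<close> exceeds \<open>N\<close>.\<close>
    show "0 < (e / N) powr \<alpha>"
      using N \<open>0 < e\<close> by simp
    fix n :: nat and t c :: "nat \<Rightarrow> real"
    assume t: "mono_on {..n} t" and less: "(\<Sum>i<n. \<bar>c i\<bar> powr \<alpha> * (t (Suc i) - t i)) < (e / N) powr \<alpha>"
    define s where "s = (\<Sum>i<n. \<bar>c i\<bar> powr \<alpha> * (t (Suc i) - t i))"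
    have "s \<ge> 0"
      unfolding s_def using t by (intro sum_nonneg mult_nonneg_nonneg) (auto simp: mono_on_def)
    then have "s powr (1 / \<alpha>) \<le> ((e / N) powr \<alpha>) powr (1 / \<alpha>)"
      using less \<alpha> unfolding s_def by (intro powr_mono2) auto
    also have "\<dots> = e / N"
      using \<alpha> N \<open>0 < e\<close> by (simp add: powr_powr)
    finally have root: "s powr (1 / \<alpha>) * N \<le> e"
      using N by (simp add: field_simps)
    let ?A = "{x::real. \<bar>x\<bar> > e}" and ?S = "\<lambda>\<omega>. \<Sum>i<n. c i * (X (t (Suc i)) \<omega> - X (t i) \<omega>)"
    have "prob {\<omega> \<in> space M. \<bar>?S \<omega>\<bar> > e} = measure (distr M borel ?S) ?A"
      by (subst measure_distr) (auto simp: vimage_def Int_def conj_commute)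
    also have "\<dots> = measure (distr M borel (\<lambda>\<omega>. s powr (1 / \<alpha>) * ?W \<omega>)) ?A"
      using distr_increment_sum[OF \<alpha> t s_def] by simp
    also have "\<dots> = prob {\<omega> \<in> space M. \<bar>s powr (1 / \<alpha>) * ?W \<omega>\<bar> > e}"
      by (subst measure_distr) (auto simp: vimage_def Int_def conj_commute)
    also have "\<dots> \<le> prob {\<omega> \<in> space M. \<bar>?W \<omega>\<bar> > N}"
    proof (intro finite_measure_mono subsetI)
      fix \<omega> assume \<omega>: "\<omega> \<in> {\<omega> \<in> space M. \<bar>s powr (1 / \<alpha>) * ?W \<omega>\<bar> > e}"
      have "\<not> \<bar>?W \<omega>\<bar> \<le> N"
      proof
        assume "\<bar>?W \<omega>\<bar> \<le> N"
        then have "s powr (1 / \<alpha>) * \<bar>?W \<omega>\<bar> \<le> e"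
          using root mult_left_mono[of "\<bar>?W \<omega>\<bar>" N "s powr (1 / \<alpha>)"] by simp
        with \<omega> show False
          by (simp add: abs_mult)
      qed
      with \<omega> show "\<omega> \<in> {\<omega> \<in> space M. \<bar>?W \<omega>\<bar> > N}"
        by auto
    qed measurable
    finally show "prob {\<omega> \<in> space M. \<bar>?S \<omega>\<bar> > e} < r"
      using N(2) by simp
  qed
qed

lemma prob_rs_sum_small:
  assumes \<alpha>: "0 < \<alpha>" and "0 < e" "0 < r" "a \<le> b"
  obtains d where "0 < d"
    "\<And>h D. D tagged_division_of {a..b} \<Longrightarrow> (\<Sum>(x, K)\<in>D. \<bar>h x\<bar> powr \<alpha> * (Sup K - Inf K)) < d \<Longrightarrow>
      prob {\<omega> \<in> space M. \<bar>rs_sum X h D \<omega>\<bar> > e} < r"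
proof -
  obtain d where d: "0 < d"
    "\<And>n t c. mono_on {..n} t \<Longrightarrow> (\<Sum>i<n. \<bar>c i\<bar> powr \<alpha> * (t (Suc i) - t i)) < d \<Longrightarrow>
      prob {\<omega> \<in> space M. \<bar>\<Sum>i<n. c i * (X (t (Suc i)) \<omega> - X (t i) \<omega>)\<bar> > e} < r"
    using prob_increment_sum_small[OF assms(1-3)] by blast
  show thesis
  proof (rule that[OF d(1)])
    fix h D assume D: "D tagged_division_of {a..b}"
      and less: "(\<Sum>(x, K)\<in>D. \<bar>h x\<bar> powr \<alpha> * (Sup K - Inf K)) < d"
    obtain n and t :: "nat \<Rightarrow> real" where t: "strict_mono_on {..n} t" "t ` {..n} \<subseteq> {a..b}"
      "division_endpoints D \<subseteq> t ` {..n}"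
      using common_refinement[OF \<open>a \<le> b\<close> D D] by metis
    have coeff: "\<bar>step_value h D (t i) (t (Suc i))\<bar> powr \<alpha> =
        step_value (\<lambda>x. \<bar>h x\<bar> powr \<alpha>) D (t i) (t (Suc i))" if "i < n" for i
    proof -
      have *: "a \<le> t i" "t (Suc i) \<le> b" "division_endpoints D \<inter> {t i<..<t (Suc i)} = {}"
        using t(2,3) strict_mono_on_consecutive(2)[OF t(1) that] that
        by (auto simp: image_subset_iff)
      from step_value_eq[OF D strict_mono_on_consecutive(1)[OF t(1) that] *]
      show ?thesis by metis
    qed
    \<comment> \<open>The identity path, over a dummy sample point \<open>()\<close>, turns
      \<open>rs_sum\<close> into the ordinary Riemann sum of
      \<open>\<bar>h x\<bar> powr \<alpha>\<close>.\<close>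
    have "(\<Sum>i<n. \<bar>step_value h D (t i) (t (Suc i))\<bar> powr \<alpha> * (t (Suc i) - t i)) =
        rs_sum (\<lambda>v _. v) (\<lambda>x. \<bar>h x\<bar> powr \<alpha>) D ()"
      unfolding rs_sum_eq_sum_step_value[OF D t(1,3)] by (intro sum.cong) (auto simp: coeff)
    also have "\<dots> < d"
      using less unfolding rs_sum_def .
    finally show "prob {\<omega> \<in> space M. \<bar>rs_sum X h D \<omega>\<bar> > e} < r"
      unfolding rs_sum_eq_sum_step_value[OF D t(1,3)]
      by (intro d(2) strict_mono_on_imp_mono_on t(1))
  qed
qed

section \<open>Existence and continuity of the stochastic integral\<close>

text \<open>Over a common refinement both sums use the same increments, and by uniform continuity of
  \<open>h\<close> their coefficients differ by at most \<open>\<kappa>\<close> everywhere.\<close>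

lemma rs_sum_Cauchy:
  assumes \<alpha>: "0 < \<alpha>" and "0 < e" "0 < r" "a \<le> b" and h: "continuous_on {a..b} h"
  shows "eventually (\<lambda>(D, D'). prob {\<omega> \<in> space M. \<bar>rs_sum X h D \<omega> - rs_sum X h D' \<omega>\<bar> > e} < r)
    (mesh_filter a b \<times>\<^sub>F mesh_filter a b)"
proof -
  obtain d where d: "0 < d"
    "\<And>n t c. mono_on {..n} t \<Longrightarrow> (\<Sum>i<n. \<bar>c i\<bar> powr \<alpha> * (t (Suc i) - t i)) < d \<Longrightarrow>
      prob {\<omega> \<in> space M. \<bar>\<Sum>i<n. c i * (X (t (Suc i)) \<omega> - X (t i) \<omega>)\<bar> > e} < r"
    using prob_increment_sum_small[OF assms(1-3)] by blast
  \<comment> \<open>Solves \<open>\<kappa> powr \<alpha> * (b - a + 1) = d\<close>. The added 1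
    covers \<open>a = b\<close> and makes \<open>\<kappa> powr \<alpha> * (b - a) < d\<close>
    strict.\<close>
  define \<kappa> where "\<kappa> = (d / (b - a + 1)) powr (1 / \<alpha>)"
  have "\<kappa> > 0" "\<kappa> powr \<alpha> = d / (b - a + 1)"
    using d(1) \<alpha> \<open>a \<le> b\<close> unfolding \<kappa>_def by (auto simp: powr_powr)
  then have "\<kappa> powr \<alpha> * (b - a) + \<kappa> powr \<alpha> = d" "\<kappa> powr \<alpha> > 0"
    using \<open>a \<le> b\<close> by (auto simp: field_simps)
  then have \<kappa>: "\<kappa> > 0" "\<kappa> powr \<alpha> * (b - a) < d"
    using \<open>\<kappa> > 0\<close> by auto
  have "uniformly_continuous_on {a..b} h"
    using h by (intro compact_uniformly_continuous) auto
  then obtain \<delta> where \<delta>: "\<delta> > 0"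
    "\<And>x y. x \<in> {a..b} \<Longrightarrow> y \<in> {a..b} \<Longrightarrow> \<bar>y - x\<bar> < \<delta> \<Longrightarrow> \<bar>h y - h x\<bar> < \<kappa>"
    using \<kappa>(1) unfolding uniformly_continuous_on_def dist_real_def by meson
  \<comment> \<open>Members of \<open>D\<close> and \<open>D'\<close> over the same piece of the
    refinement overlap, so mesh \<open>\<delta> / 2\<close> in each keeps their tags within
    \<open>\<delta>\<close>.\<close>
  define Q where "Q D \<longleftrightarrow> D tagged_division_of {a..b} \<and> (\<forall>(x, K)\<in>D. Sup K - Inf K < \<delta> / 2)" for D
  have "eventually Q (mesh_filter a b)"
    unfolding eventually_mesh_filter Q_def using \<delta>(1) half_gt_zero by blast
  moreover have "prob {\<omega> \<in> space M. \<bar>rs_sum X h D \<omega> - rs_sum X h D' \<omega>\<bar> > e} < r"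
    if "Q D" "Q D'" for D D'
  proof -
    from that have D: "D tagged_division_of {a..b}" "\<forall>(x, K)\<in>D. Sup K - Inf K < \<delta> / 2"
      and D': "D' tagged_division_of {a..b}" "\<forall>(x, K)\<in>D'. Sup K - Inf K < \<delta> / 2"
      unfolding Q_def by auto
    obtain n and t :: "nat \<Rightarrow> real" where t: "strict_mono_on {..n} t" "t ` {..n} \<subseteq> {a..b}"
      "division_endpoints D \<subseteq> t ` {..n}" "division_endpoints D' \<subseteq> t ` {..n}"
      by (rule common_refinement[OF \<open>a \<le> b\<close> D(1) D'(1)])
    let ?c = "\<lambda>i. step_value h D (t i) (t (Suc i)) - step_value h D' (t i) (t (Suc i))"
    have c: "\<bar>?c i\<bar> \<le> \<kappa>" if "i < n" for i
    proof -
      note less = strict_mono_on_consecutive(1)[OF t(1) that]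
      have in_ab: "a \<le> t i" "t (Suc i) \<le> b"
        using t(2) that by (auto simp: image_subset_iff)
      have "division_endpoints D \<inter> {t i<..<t (Suc i)} = {}"
          "division_endpoints D' \<inter> {t i<..<t (Suc i)} = {}"
        using t(3,4) strict_mono_on_consecutive(2)[OF t(1) that] by auto
      with less in_ab obtain x K x' K' where
          K: "(x, K) \<in> D" "Inf K \<le> t i" "t (Suc i) \<le> Sup K" "step_value h D (t i) (t (Suc i)) = h x"
        and K': "(x', K') \<in> D'" "Inf K' \<le> t i" "t (Suc i) \<le> Sup K'" "step_value h D' (t i) (t (Suc i)) = h x'"
        using step_value_eq[OF D(1)] step_value_eq[OF D'(1)] by metis
      have "Sup K - Inf K < \<delta> / 2" "Sup K' - Inf K' < \<delta> / 2"
        using D(2) K(1) D'(2) K'(1) by auto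
      with tagged_division_interval[OF D(1) K(1)] tagged_division_interval[OF D'(1) K'(1)] K K' less
      have "x \<in> {a..b}" "x' \<in> {a..b}" "\<bar>x - x'\<bar> < \<delta>"
        by auto
      from \<delta>(2)[OF this(2,1,3)] show ?thesis
        unfolding K(4) K'(4) by simp
    qed
    have "(\<Sum>i<n. \<bar>?c i\<bar> powr \<alpha> * (t (Suc i) - t i)) \<le> (\<Sum>i<n. \<kappa> powr \<alpha> * (t (Suc i) - t i))"
      using c \<alpha> strict_mono_on_consecutive(1)[OF t(1)]
      by (intro sum_mono mult_mono powr_mono2) (auto intro: less_imp_le)
    also have "\<dots> = \<kappa> powr \<alpha> * (t n - t 0)"
      unfolding sum_distrib_left[symmetric] by (simp add: sum_lessThan_telescope)
    also have "\<dots> \<le> \<kappa> powr \<alpha> * (b - a)"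
    proof -
      have "t n \<le> b" "a \<le> t 0"
        using t(2) by (auto simp: image_subset_iff)
      then show ?thesis
        by (intro mult_left_mono) auto
    qed
    finally have "(\<Sum>i<n. \<bar>?c i\<bar> powr \<alpha> * (t (Suc i) - t i)) < d"
      using \<kappa>(2) by simp
    then have "prob {\<omega> \<in> space M. \<bar>\<Sum>i<n. ?c i * (X (t (Suc i)) \<omega> - X (t i) \<omega>)\<bar> > e} < r"
      by (intro d(2) strict_mono_on_imp_mono_on t(1))
    moreover have "rs_sum X h D \<omega> - rs_sum X h D' \<omega> =
        (\<Sum>i<n. ?c i * (X (t (Suc i)) \<omega> - X (t i) \<omega>))" for \<omega>
      unfolding rs_sum_eq_sum_step_value[OF D(1) t(1,3)] rs_sum_eq_sum_step_value[OF D'(1) t(1,4)]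
      by (simp add: sum_subtractf left_diff_distrib)
    ultimately show ?thesis
      by simp
  qed
  ultimately show ?thesis
    unfolding eventually_prod_same by blast
qed

text \<open>Existence of the limit makes the \<open>SOME\<close> in \<open>stoch_integral\<close>
  denote an actual integral.\<close>

lemma has_stoch_integral_stoch_integral:
  assumes \<alpha>: "0 < \<alpha>" and "a \<le> b" and h: "continuous_on {a..b} h"
  shows "has_stoch_integral M X a b h (stoch_integral M X a b h)"
proof -
  have "\<exists>J \<in> borel_measurable M. tendsto_in_prob M (rs_sum X h) J (mesh_filter a b)"
    using assms by (intro Cauchy_in_prob_convergent mesh_filter_neq_bot rs_sum_Cauchy) auto
  then have "\<exists>J. has_stoch_integral M X a b h J"
    unfolding has_stoch_integral_def by blast
  then show ?thesis
    unfolding stoch_integral_def by (rule someI_ex)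
qed

text \<open>One division is taken fine enough for three purposes at once: both Riemann-Stieltjes
  sums are near their integrals, and the Riemann sum of
  \<open>\<bar>h x - h' x\<bar> powr \<alpha>\<close> is near its integral. The bound
  \<open>d\<close> is uniform in \<open>h\<close> and \<open>h'\<close>.\<close>

lemma prob_stoch_integral_diff_small:
  assumes \<alpha>: "0 < \<alpha>" and "0 < e" "0 < r" "a \<le> b"
  obtains d where "0 < d"
    "\<And>h h'. continuous_on {a..b} h \<Longrightarrow> continuous_on {a..b} h' \<Longrightarrow>
      integral {a..b} (\<lambda>x. \<bar>h x - h' x\<bar> powr \<alpha>) < d \<Longrightarrow>
      prob {\<omega> \<in> space M. \<bar>stoch_integral M X a b h \<omega> - stoch_integral M X a b h' \<omega>\<bar> > e} < r"
proof -
  \<comment> \<open>The triangle inequality is used twice, whence the tolerance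
    \<open>e / 2 / 2\<close> and three probabilities of \<open>r / 3\<close>.\<close>
  obtain d where d: "0 < d"
    "\<And>h D. D tagged_division_of {a..b} \<Longrightarrow> (\<Sum>(x, K)\<in>D. \<bar>h x\<bar> powr \<alpha> * (Sup K - Inf K)) < d \<Longrightarrow>
      prob {\<omega> \<in> space M. \<bar>rs_sum X h D \<omega>\<bar> > e / 2 / 2} < r / 3"
    using prob_rs_sum_small[of "e / 2 / 2" "r / 3" a b] assms by auto
  show thesis
  proof (rule that[OF d(1)])
    fix h h' assume h: "continuous_on {a..b} h" "continuous_on {a..b} h'"
      and less: "integral {a..b} (\<lambda>x. \<bar>h x - h' x\<bar> powr \<alpha>) < d"
    let ?J = "stoch_integral M X a b h" and ?J' = "stoch_integral M X a b h'"
    let ?I = "integral {a..b} (\<lambda>x. \<bar>h x - h' x\<bar> powr \<alpha>)"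
    have J [measurable]: "?J \<in> borel_measurable M" "tendsto_in_prob M (rs_sum X h) ?J (mesh_filter a b)"
      and J' [measurable]: "?J' \<in> borel_measurable M" "tendsto_in_prob M (rs_sum X h') ?J' (mesh_filter a b)"
      using has_stoch_integral_stoch_integral[OF \<alpha> \<open>a \<le> b\<close>] h unfolding has_stoch_integral_def by auto
    have "((\<lambda>x. \<bar>h x - h' x\<bar> powr \<alpha>) has_integral ?I) {a..b}"
      using h \<alpha>
      by (intro integrable_integral integrable_continuous_interval continuous_on_powr' continuous_intros) auto
    \<comment> \<open>This gap is the accuracy asked of the Riemann sum, which keeps that sum below
      \<open>d\<close>.\<close>
    moreover have "d - ?I > 0"
      using less by simp
    moreover have "eventually (\<lambda>D. prob {\<omega> \<in> space M. \<bar>rs_sum X h D \<omega> - ?J \<omega>\<bar> > e / 2} < r / 3 \<and>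
        prob {\<omega> \<in> space M. \<bar>rs_sum X h' D \<omega> - ?J' \<omega>\<bar> > e / 2 / 2} < r / 3) (mesh_filter a b)"
      using \<open>0 < e\<close> \<open>0 < r\<close> by (intro eventually_conj tendsto_in_probD[OF J(2)] tendsto_in_probD[OF J'(2)]) auto
    ultimately obtain D where D: "D tagged_division_of {a..b}"
      "prob {\<omega> \<in> space M. \<bar>rs_sum X h D \<omega> - ?J \<omega>\<bar> > e / 2} < r / 3"
      "prob {\<omega> \<in> space M. \<bar>rs_sum X h' D \<omega> - ?J' \<omega>\<bar> > e / 2 / 2} < r / 3"
      "\<bar>(\<Sum>(x, K)\<in>D. \<bar>h x - h' x\<bar> powr \<alpha> * (Sup K - Inf K)) - ?I\<bar> < d - ?I"
      by (rule mesh_filter_riemann_sum) blast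
    have "prob {\<omega> \<in> space M. \<bar>?J \<omega> - ?J' \<omega>\<bar> > e} \<le>
        prob {\<omega> \<in> space M. \<bar>?J \<omega> - rs_sum X h D \<omega>\<bar> > e / 2} +
        prob {\<omega> \<in> space M. \<bar>rs_sum X h D \<omega> - ?J' \<omega>\<bar> > e / 2}"
      by (intro prob_abs_diff_triangle) measurable
    also have "\<dots> \<le> prob {\<omega> \<in> space M. \<bar>?J \<omega> - rs_sum X h D \<omega>\<bar> > e / 2} +
        (prob {\<omega> \<in> space M. \<bar>rs_sum X h D \<omega> - rs_sum X h' D \<omega>\<bar> > e / 2 / 2} +
         prob {\<omega> \<in> space M. \<bar>rs_sum X h' D \<omega> - ?J' \<omega>\<bar> > e / 2 / 2})"
      by (intro add_left_mono prob_abs_diff_triangle) measurable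
    also have "\<dots> < r / 3 + (r / 3 + r / 3)"
    proof (intro add_strict_mono)
      show "prob {\<omega> \<in> space M. \<bar>?J \<omega> - rs_sum X h D \<omega>\<bar> > e / 2} < r / 3"
        using D(2) by (simp add: abs_minus_commute)
      show "prob {\<omega> \<in> space M. \<bar>rs_sum X h D \<omega> - rs_sum X h' D \<omega>\<bar> > e / 2 / 2} < r / 3"
        unfolding rs_sum_diff using D(4) by (intro d(2) D(1)) linarith
    qed (fact D(3))
    finally show "prob {\<omega> \<in> space M. \<bar>?J \<omega> - ?J' \<omega>\<bar> > e} < r"
      by simp
  qed
qed

end

section \<open>The Jacobi weight\<close>

text \<open>Plays the part of Hoelder's inequality in passing from exponent \<open>p\<close> to
  \<open>\<alpha>\<close> on a finite measure. Where \<open>\<bar>y\<bar> powr \<alpha>\<close>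
  exceeds \<open>\<tau>\<close>, the exponent \<open>1 - p / \<alpha> \<le> 0\<close> reverses the
  comparison of the powers.\<close>

lemma powr_interpolate:
  fixes y \<tau> :: real
  assumes "0 < \<alpha>" "\<alpha> \<le> p" "0 < \<tau>"
  shows "\<bar>y\<bar> powr \<alpha> \<le> \<tau> + \<tau> powr (1 - p / \<alpha>) * \<bar>y\<bar> powr p"
proof (cases "\<bar>y\<bar> powr \<alpha> \<le> \<tau>")
  case True
  then show ?thesis
    by (simp add: add_increasing2)
next
  case False
  let ?z = "\<bar>y\<bar> powr \<alpha>"
  have "?z > 0"
    using False \<open>0 < \<tau>\<close> by linarith
  have "?z = ?z powr (1 - p / \<alpha>) * ?z powr (p / \<alpha>)"
    using \<open>?z > 0\<close> by (simp add: powr_add[symmetric])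
  also have "\<dots> \<le> \<tau> powr (1 - p / \<alpha>) * ?z powr (p / \<alpha>)"
    using False assms by (intro mult_right_mono powr_mono2') (auto simp: field_simps)
  also have "?z powr (p / \<alpha>) = \<bar>y\<bar> powr p"
    using assms by (simp add: powr_powr)
  finally show ?thesis
    using \<open>0 < \<tau>\<close> by linarith
qed

text \<open>A substitute for the triangle inequality, from
  \<open>\<bar>x - y\<bar> \<le> 2 * max \<bar>x\<bar> \<bar>y\<bar>\<close> and monotonicity of the
  power.\<close>

lemma abs_diff_powr_le:
  fixes x y :: real
  assumes "0 \<le> p"
  shows "\<bar>x - y\<bar> powr p \<le> 2 powr p * (\<bar>x\<bar> powr p + \<bar>y\<bar> powr p)"
proof -
  have "\<bar>x - y\<bar> powr p \<le> (2 * max \<bar>x\<bar> \<bar>y\<bar>) powr p"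
    using assms by (intro powr_mono2) auto
  also have "\<dots> = 2 powr p * max \<bar>x\<bar> \<bar>y\<bar> powr p"
    by (simp add: powr_mult)
  also have "\<dots> \<le> 2 powr p * (\<bar>x\<bar> powr p + \<bar>y\<bar> powr p)"
    by (intro mult_left_mono) (auto simp: max_def)
  finally show ?thesis .
qed

lemma jacobi_weight_nonneg: "0 \<le> jacobi_weight \<zeta> \<eta> v"
  by (simp add: jacobi_weight_def)

lemma continuous_on_jacobi_weight:
  assumes "0 \<le> \<zeta>" "0 \<le> \<eta>"
  shows "continuous_on {-1..1} (jacobi_weight \<zeta> \<eta>)"
proof -
  have "continuous_on {-1..1} (\<lambda>v::real. if \<zeta> = 0 then 1 else (1 - v) powr \<zeta>)"
    using assms by (cases "\<zeta> = 0") (simp_all, intro continuous_on_powr' continuous_intros, auto)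
  moreover have "continuous_on {-1..1} (\<lambda>v::real. if \<eta> = 0 then 1 else (1 + v) powr \<eta>)"
    using assms by (cases "\<eta> = 0") (simp_all, intro continuous_on_powr' continuous_intros, auto)
  ultimately show ?thesis
    unfolding jacobi_weight_def by (rule continuous_on_mult)
qed

lemma borel_measurable_lebesgue_on_continuous:
  fixes f :: "real \<Rightarrow> real"
  assumes "continuous_on {a..b} f"
  shows "f \<in> borel_measurable (lebesgue_on {a..b})"
  using assms by (intro continuous_imp_measurable_on_sets_lebesgue) auto

section \<open>Integrals with respect to the Jacobi measure\<close>

context
  fixes \<zeta> \<eta> :: real
  assumes nonneg: "0 \<le> \<zeta>" "0 \<le> \<eta>"
begin

lemma borel_measurable_jacobi_measure:
  fixes f :: "real \<Rightarrow> real"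
  shows "f \<in> borel_measurable (jacobi_measure \<zeta> \<eta>) \<longleftrightarrow> f \<in> borel_measurable (lebesgue_on {-1..1})"
proof -
  have "(borel_measurable (jacobi_measure \<zeta> \<eta>) :: (real \<Rightarrow> real) set) =
      borel_measurable (lebesgue_on {-1..1})"
    unfolding jacobi_measure_def by (intro measurable_cong_sets) auto
  then show ?thesis
    by simp
qed

lemma
  fixes f :: "real \<Rightarrow> real"
  assumes "f \<in> borel_measurable (lebesgue_on {-1..1})"
  shows integrable_jacobi_measure_iff: "integrable (jacobi_measure \<zeta> \<eta>) f \<longleftrightarrow>
      integrable (lebesgue_on {-1..1}) (\<lambda>v. jacobi_weight \<zeta> \<eta> v * f v)"
    and integral_jacobi_measure: "(\<integral>v. f v \<partial>jacobi_measure \<zeta> \<eta>) =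
      (\<integral>v. jacobi_weight \<zeta> \<eta> v * f v \<partial>lebesgue_on {-1..1})"
  unfolding jacobi_measure_def
  using borel_measurable_lebesgue_on_continuous[OF continuous_on_jacobi_weight[OF nonneg]] assms
  by (simp_all add: integrable_density integral_density jacobi_weight_nonneg)

lemma continuous_imp_integrable_jacobi_measure:
  fixes f :: "real \<Rightarrow> real"
  assumes "continuous_on {-1..1} f"
  shows "integrable (jacobi_measure \<zeta> \<eta>) f"
  using assms continuous_on_jacobi_weight[OF nonneg]
  by (subst integrable_jacobi_measure_iff)
    (auto intro: borel_measurable_lebesgue_on_continuous continuous_imp_integrable_real continuous_on_mult)

text \<open>A non-integrable function has Bochner integral 0 by convention; integrability ensures
  that a small integral of \<open>\<bar>u v - g v\<bar> powr p\<close> really expresses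
  closeness.\<close>

lemma integrable_diff_Lp_jacobi:
  assumes p: "1 \<le> p" and g: "g \<in> Lp_jacobi p \<zeta> \<eta>" and u: "continuous_on {-1..1} u"
  shows "integrable (jacobi_measure \<zeta> \<eta>) (\<lambda>v. \<bar>u v - g v\<bar> powr p)"
proof (rule Bochner_Integration.integrable_bound)
  have "continuous_on {-1..1} (\<lambda>v. \<bar>u v\<bar> powr p)"
    using u p by (intro continuous_on_powr' continuous_intros) auto
  then have "integrable (jacobi_measure \<zeta> \<eta>) (\<lambda>v. \<bar>u v\<bar> powr p)"
    by (rule continuous_imp_integrable_jacobi_measure)
  moreover have "integrable (jacobi_measure \<zeta> \<eta>) (\<lambda>v. \<bar>g v\<bar> powr p)"
    using g by (simp add: Lp_jacobi_def)
  ultimately show "integrable (jacobi_measure \<zeta> \<eta>) (\<lambda>v. 2 powr p * (\<bar>u v\<bar> powr p + \<bar>g v\<bar> powr p))"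
    by (intro integrable_mult_right Bochner_Integration.integrable_add)
  have [measurable]: "g \<in> borel_measurable (jacobi_measure \<zeta> \<eta>)" "u \<in> borel_measurable (jacobi_measure \<zeta> \<eta>)"
    using g borel_measurable_lebesgue_on_continuous[OF u]
    by (auto simp: Lp_jacobi_def borel_measurable_jacobi_measure)
  show "(\<lambda>v. \<bar>u v - g v\<bar> powr p) \<in> borel_measurable (jacobi_measure \<zeta> \<eta>)"
    by measurable
  show "AE v in jacobi_measure \<zeta> \<eta>. norm (\<bar>u v - g v\<bar> powr p) \<le> norm (2 powr p * (\<bar>u v\<bar> powr p + \<bar>g v\<bar> powr p))"
    using p abs_diff_powr_le[of p] by (intro AE_I2) auto
qed

text \<open>The integrand is \<open>w powr \<alpha> * \<bar>u - v\<bar> powr \<alpha>\<close> with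
  \<open>w\<close> the weight. One factor \<open>w\<close> is kept as the density of the measure;
  the other factor is split into a small constant and a multiple of the \<open>p\<close>-th powers
  of \<open>u - g\<close> and \<open>v - g\<close>.\<close>

lemma Lp_jacobi_close_imp_integral_small:
  assumes \<alpha>: "1 \<le> \<alpha>" "\<alpha> \<le> p" and g: "g \<in> Lp_jacobi p \<zeta> \<eta>" and "0 < d"
  obtains \<kappa> where "0 < \<kappa>"
    "\<And>u v. continuous_on {-1..1} u \<Longrightarrow> continuous_on {-1..1} v \<Longrightarrow>
      (\<integral>x. \<bar>u x - g x\<bar> powr p \<partial>jacobi_measure \<zeta> \<eta>) < \<kappa> \<Longrightarrow>
      (\<integral>x. \<bar>v x - g x\<bar> powr p \<partial>jacobi_measure \<zeta> \<eta>) < \<kappa> \<Longrightarrow>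
      integral {-1..1} (\<lambda>x. \<bar>u x * jacobi_weight \<zeta> \<eta> x - v x * jacobi_weight \<zeta> \<eta> x\<bar> powr \<alpha>) < d"
proof -
  let ?w = "jacobi_weight \<zeta> \<eta>" and ?\<mu> = "jacobi_measure \<zeta> \<eta>"
  have "bounded (?w ` {-1..1})"
    using continuous_on_jacobi_weight[OF nonneg] by (intro compact_imp_bounded compact_continuous_image) auto
  then obtain B where B: "B > 0" "\<And>x. x \<in> {-1..1} \<Longrightarrow> ?w x \<le> B"
    unfolding bounded_pos using jacobi_weight_nonneg by fastforce
  \<comment> \<open>Bounds the excess power \<open>w powr (\<alpha> - 1)\<close>, as
    \<open>\<alpha> \<ge> 1\<close> makes the exponent nonnegative.\<close>
  define C where "C = B powr (\<alpha> - 1)"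
  have "C > 0"
    using B(1) by (simp add: C_def)
  have w_le: "?w x powr \<alpha> \<le> ?w x * C" if "x \<in> {-1..1}" for x
  proof -
    have "?w x powr \<alpha> = ?w x * ?w x powr (\<alpha> - 1)"
      using jacobi_weight_nonneg[of \<zeta> \<eta> x] by (cases "?w x = 0") (auto simp: powr_diff)
    also have "\<dots> \<le> ?w x * C"
      unfolding C_def using B(2)[OF that] \<alpha> jacobi_weight_nonneg by (intro mult_left_mono powr_mono2) auto
    finally show ?thesis .
  qed
  define T where "T = (\<integral>x. (1::real) \<partial>?\<mu>)"
  have "T \<ge> 0"
    by (simp add: T_def)
  \<comment> \<open>Adding 1 to the total mass \<open>T\<close> gives a positive divisor and the
    strict bound \<open>C * \<tau> * T < d / 2\<close>.\<close>
  define S where "S = T + 1"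
  have "S > 0"
    using \<open>T \<ge> 0\<close> by (simp add: S_def)
  define \<tau> where "\<tau> = d / (2 * C * S)"
  have "\<tau> > 0"
    using \<open>C > 0\<close> \<open>S > 0\<close> \<open>0 < d\<close> by (simp add: \<tau>_def)
  have "C * \<tau> * S = d / 2"
    using \<open>C > 0\<close> \<open>S > 0\<close> by (simp add: \<tau>_def)
  then have "C * \<tau> * T + C * \<tau> = d / 2"
    by (simp add: S_def distrib_left)
  then have \<tau>: "C * \<tau> * T < d / 2"
    using mult_pos_pos[OF \<open>C > 0\<close> \<open>\<tau> > 0\<close>] by linarith
  \<comment> \<open>The coefficient of the two \<open>p\<close>-th power integrals; with both below
    \<open>d / (4 * A)\<close> they contribute less than \<open>d / 2\<close>.\<close>
  define A where "A = C * (\<tau> powr (1 - p / \<alpha>) * 2 powr p)"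
  have "A > 0"
    using \<open>C > 0\<close> \<open>\<tau> > 0\<close> by (simp add: A_def)
  show thesis
  proof (rule that[of "d / (4 * A)"])
    show "0 < d / (4 * A)"
      using \<open>A > 0\<close> \<open>0 < d\<close> by simp
    fix u v assume u: "continuous_on {-1..1} u" and v: "continuous_on {-1..1} v"
      and u_less: "(\<integral>x. \<bar>u x - g x\<bar> powr p \<partial>?\<mu>) < d / (4 * A)"
      and v_less: "(\<integral>x. \<bar>v x - g x\<bar> powr p \<partial>?\<mu>) < d / (4 * A)"
    let ?F = "\<lambda>x. \<bar>u x * ?w x - v x * ?w x\<bar> powr \<alpha>"
    \<comment> \<open>The factor 1 is kept so that linearity of the integral produces
      \<open>T\<close>, the integral of the constant 1.\<close>
    let ?G = "\<lambda>x. C * \<tau> * 1 + A * (\<bar>u x - g x\<bar> powr p + \<bar>v x - g x\<bar> powr p)"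
    have "1 \<le> p"
      using \<alpha> by simp
    note int = integrable_diff_Lp_jacobi[OF this g u] integrable_diff_Lp_jacobi[OF this g v]
      continuous_imp_integrable_jacobi_measure[OF continuous_on_const[of _ "1::real"]]
    have intG: "integrable ?\<mu> ?G"
      by (intro Bochner_Integration.integrable_add integrable_mult_right int)
    then have measG: "?G \<in> borel_measurable (lebesgue_on {-1..1})"
      using borel_measurable_integrable borel_measurable_jacobi_measure by blast
    have intF: "integrable (lebesgue_on {-1..1}) ?F"
      using u v \<alpha> continuous_on_jacobi_weight[OF nonneg]
      by (intro continuous_imp_integrable_real continuous_on_powr' continuous_intros) auto
    have "?F x \<le> ?w x * ?G x" if "x \<in> {-1..1}" for x
    proof -
      let ?S = "2 powr p * (\<bar>u x - g x\<bar> powr p + \<bar>v x - g x\<bar> powr p)"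
      have "\<bar>u x - v x\<bar> powr \<alpha> \<le> \<tau> + \<tau> powr (1 - p / \<alpha>) * \<bar>u x - v x\<bar> powr p"
        using \<alpha> \<open>\<tau> > 0\<close> by (intro powr_interpolate) auto
      also have "\<dots> \<le> \<tau> + \<tau> powr (1 - p / \<alpha>) * ?S"
        using abs_diff_powr_le[of p "u x - g x" "v x - g x"] \<alpha>
        by (intro add_left_mono mult_left_mono) auto
      finally have bound: "\<bar>u x - v x\<bar> powr \<alpha> \<le> \<tau> + \<tau> powr (1 - p / \<alpha>) * ?S" .
      have "?F x = ?w x powr \<alpha> * \<bar>u x - v x\<bar> powr \<alpha>"
        using jacobi_weight_nonneg by (simp add: left_diff_distrib[symmetric] abs_mult powr_mult)
      also have "\<dots> \<le> (?w x * C) * (\<tau> + \<tau> powr (1 - p / \<alpha>) * ?S)"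
        using w_le[OF that] bound \<open>C > 0\<close> jacobi_weight_nonneg by (intro mult_mono) auto
      also have "\<dots> = ?w x * ?G x"
        unfolding A_def by (simp add: algebra_simps)
      finally show ?thesis .
    qed
    then have "(\<integral>x. ?F x \<partial>lebesgue_on {-1..1}) \<le> (\<integral>x. ?w x * ?G x \<partial>lebesgue_on {-1..1})"
      using intG integrable_jacobi_measure_iff[OF measG] by (intro integral_mono intF) auto
    also have "\<dots> = (\<integral>x. ?G x \<partial>?\<mu>)"
      by (rule integral_jacobi_measure[OF measG, symmetric])
    also have "\<dots> = C * \<tau> * T + A * ((\<integral>x. \<bar>u x - g x\<bar> powr p \<partial>?\<mu>) + (\<integral>x. \<bar>v x - g x\<bar> powr p \<partial>?\<mu>))"
      unfolding T_def
      by (simp only: Bochner_Integration.integral_add integral_mult_right_zero int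
          Bochner_Integration.integrable_add integrable_mult_right)
    also have "\<dots> < d / 2 + A * (d / (4 * A) + d / (4 * A))"
      using \<tau> \<open>A > 0\<close> u_less v_less by (intro add_strict_mono mult_strict_left_mono) auto
    also have "\<dots> = d"
      using \<open>A > 0\<close> by (simp add: field_simps)
    finally show "integral {-1..1} ?F < d"
      using lebesgue_integral_eq_integral[OF intF] by simp
  qed
qed

end

section \<open>The common limit of all approximating sequences\<close>

theorem theorem3:
  fixes M :: "'w measure" and X :: "real \<Rightarrow> 'w \<Rightarrow> real"
    and \<zeta> \<eta> \<alpha> p :: real and g :: "real \<Rightarrow> real"
  assumes "0 \<le> \<zeta>" and "0 \<le> \<eta>"
    and "1 \<le> \<alpha>" and "\<alpha> \<le> 2" and "\<alpha> \<le> p"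
    and "symmetric_stable_process M X \<alpha>"
    and "g \<in> Lp_jacobi p \<zeta> \<eta>"
  shows "\<exists>J \<in> borel_measurable M.
    \<forall>gs :: nat \<Rightarrow> real \<Rightarrow> real.
      (\<forall>m. continuous_on {-1..1} (gs m)) \<longrightarrow>
      (\<lambda>m. \<integral>v. \<bar>gs m v - g v\<bar> powr p \<partial>jacobi_measure \<zeta> \<eta>) \<longlonglongrightarrow> 0 \<longrightarrow>
        tendsto_in_prob M (\<lambda>m. jacobi_process_integral M X \<zeta> \<eta> (gs m)) J sequentially \<and>
        (\<forall>J' \<in> borel_measurable M.
           tendsto_in_prob M (\<lambda>m. jacobi_process_integral M X \<zeta> \<eta> (gs m)) J' sequentially \<longrightarrow>
           (AE \<omega> in M. J' \<omega> = J \<omega>))"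
proof -
  interpret symmetric_stable_process M X \<alpha>
    by fact
  have \<alpha>: "0 < \<alpha>"
    using assms(3) by simp
  let ?I = "jacobi_process_integral M X \<zeta> \<eta>"
  define approx where "approx gs \<longleftrightarrow> (\<forall>m. continuous_on {-1..1} (gs m)) \<and>
    (\<lambda>m. \<integral>v. \<bar>gs m v - g v\<bar> powr p \<partial>jacobi_measure \<zeta> \<eta>) \<longlonglongrightarrow> 0" for gs :: "nat \<Rightarrow> real \<Rightarrow> real"
  have cont: "continuous_on {-1..1} (\<lambda>v. u v * jacobi_weight \<zeta> \<eta> v)" if "continuous_on {-1..1} u" for u
    using that continuous_on_jacobi_weight[OF assms(1,2)] by (rule continuous_on_mult)
  have I_meas: "?I u \<in> borel_measurable M" if "continuous_on {-1..1} u" for u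
    using has_stoch_integral_stoch_integral[OF \<alpha> _ cont[OF that]]
    unfolding jacobi_process_integral_def has_stoch_integral_def by simp
  \<comment> \<open>Stated for two sequences: with \<open>hs = gs\<close> it is the Cauchy property,
    and for different sequences it forces a common limit.\<close>
  have close: "\<exists>N. \<forall>m\<ge>N. \<forall>n\<ge>N. prob {\<omega> \<in> space M. \<bar>?I (gs m) \<omega> - ?I (hs n) \<omega>\<bar> > e} < r"
    if gs: "approx gs" and hs: "approx hs" and er: "0 < e" "0 < r" for gs hs e r
  proof -
    obtain d where d: "0 < d"
      "\<And>h h'. continuous_on {-1..1} h \<Longrightarrow> continuous_on {-1..1} h' \<Longrightarrow>
        integral {-1..1} (\<lambda>x. \<bar>h x - h' x\<bar> powr \<alpha>) < d \<Longrightarrow>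
        prob {\<omega> \<in> space M. \<bar>stoch_integral M X (-1) 1 h \<omega> - stoch_integral M X (-1) 1 h' \<omega>\<bar> > e} < r"
      using prob_stoch_integral_diff_small[OF \<alpha> er, of "-1" 1] by auto
    obtain \<kappa> where \<kappa>: "0 < \<kappa>"
      "\<And>u v. continuous_on {-1..1} u \<Longrightarrow> continuous_on {-1..1} v \<Longrightarrow>
        (\<integral>x. \<bar>u x - g x\<bar> powr p \<partial>jacobi_measure \<zeta> \<eta>) < \<kappa> \<Longrightarrow>
        (\<integral>x. \<bar>v x - g x\<bar> powr p \<partial>jacobi_measure \<zeta> \<eta>) < \<kappa> \<Longrightarrow>
        integral {-1..1} (\<lambda>x. \<bar>u x * jacobi_weight \<zeta> \<eta> x - v x * jacobi_weight \<zeta> \<eta> x\<bar> powr \<alpha>) < d"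
      using Lp_jacobi_close_imp_integral_small[OF assms(1,2,3,5,7) d(1)] by blast
    have "eventually (\<lambda>m. (\<integral>x. \<bar>fs m x - g x\<bar> powr p \<partial>jacobi_measure \<zeta> \<eta>) < \<kappa>) sequentially"
      if "approx fs" for fs
      using that \<kappa>(1) unfolding approx_def by (auto intro: order_tendstoD(2))
    then have "eventually (\<lambda>m. (\<integral>x. \<bar>gs m x - g x\<bar> powr p \<partial>jacobi_measure \<zeta> \<eta>) < \<kappa> \<and>
        (\<integral>x. \<bar>hs m x - g x\<bar> powr p \<partial>jacobi_measure \<zeta> \<eta>) < \<kappa>) sequentially"
      using gs hs by (intro eventually_conj)
    then obtain N where N: "\<And>m. m \<ge> N \<Longrightarrow> (\<integral>x. \<bar>gs m x - g x\<bar> powr p \<partial>jacobi_measure \<zeta> \<eta>) < \<kappa>"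
        "\<And>m. m \<ge> N \<Longrightarrow> (\<integral>x. \<bar>hs m x - g x\<bar> powr p \<partial>jacobi_measure \<zeta> \<eta>) < \<kappa>"
      unfolding eventually_sequentially by blast
    have "prob {\<omega> \<in> space M. \<bar>?I (gs m) \<omega> - ?I (hs n) \<omega>\<bar> > e} < r" if "m \<ge> N" "n \<ge> N" for m n
      unfolding jacobi_process_integral_def
      using gs hs that unfolding approx_def by (intro d(2) \<kappa>(2) N cont) auto
    then show ?thesis
      by blast
  qed
  have "\<exists>J \<in> borel_measurable M. \<forall>gs. approx gs \<longrightarrow> tendsto_in_prob M (\<lambda>m. ?I (gs m)) J sequentially"
  proof (cases "\<exists>gs. approx gs")
    \<comment> \<open>Without an approximating sequence the claim is vacuous, and the zero variable
      serves as \<open>J\<close>.\<close>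
    case False
    then show ?thesis
      by (intro bexI[of _ "\<lambda>_. 0"]) auto
  next
    case True
    then obtain hs where hs: "approx hs"
      by blast
    then have hs_meas: "?I (hs m) \<in> borel_measurable M" for m
      unfolding approx_def by (intro I_meas) auto
    have "\<exists>J \<in> borel_measurable M. tendsto_in_prob M (\<lambda>m. ?I (hs m)) J sequentially"
    proof (rule Cauchy_in_prob_convergent)
      show "eventually (\<lambda>m. ?I (hs m) \<in> borel_measurable M) sequentially"
        using hs_meas by simp
      fix e r :: real assume "0 < e" "0 < r"
      from close[OF hs hs this] show "eventually (\<lambda>(m, n).
          prob {\<omega> \<in> space M. \<bar>?I (hs m) \<omega> - ?I (hs n) \<omega>\<bar> > e} < r) (sequentially \<times>\<^sub>F sequentially)"
        unfolding eventually_prod_sequentially prod.case by blast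
    qed simp
    then obtain J where J [measurable]: "J \<in> borel_measurable M"
        and lim: "tendsto_in_prob M (\<lambda>m. ?I (hs m)) J sequentially"
      by blast
    \<comment> \<open>The limit \<open>J\<close> of the fixed sequence \<open>hs\<close> is
      inherited by every other \<open>gs\<close>, since \<open>?I (gs m)\<close> and
      \<open>?I (hs m)\<close> become close in probability.\<close>
    have "tendsto_in_prob M (\<lambda>m. ?I (gs m)) J sequentially" if gs: "approx gs" for gs
      unfolding tendsto_in_prob_def
    proof (intro allI impI tendstoI)
      fix e r :: real assume "0 < e" "0 < r"
      have gs_meas: "?I (gs m) \<in> borel_measurable M" for m
        using gs unfolding approx_def by (intro I_meas) auto
      obtain N where N: "\<And>m. m \<ge> N \<Longrightarrow> prob {\<omega> \<in> space M. \<bar>?I (gs m) \<omega> - ?I (hs m) \<omega>\<bar> > e / 2} < r / 2"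
        using close[OF gs hs half_gt_zero[OF \<open>0 < e\<close>] half_gt_zero[OF \<open>0 < r\<close>]] by blast
      show "eventually (\<lambda>m. dist (prob {\<omega> \<in> space M. \<bar>?I (gs m) \<omega> - J \<omega>\<bar> > e}) 0 < r) sequentially"
        using tendsto_in_probD[OF lim half_gt_zero[OF \<open>0 < e\<close>] half_gt_zero[OF \<open>0 < r\<close>]]
          eventually_ge_at_top[of N]
      proof eventually_elim
        case (elim m)
        then show ?case
          using prob_abs_diff_triangle[OF gs_meas[of m] hs_meas[of m] J, of e] N[of m] by simp
      qed
    qed
    with J show ?thesis
      by blast
  qed
  then obtain J where J: "J \<in> borel_measurable M"
      "\<And>gs. approx gs \<Longrightarrow> tendsto_in_prob M (\<lambda>m. ?I (gs m)) J sequentially"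
    by blast
  have "AE \<omega> in M. J' \<omega> = J \<omega>"
    if "approx gs" "J' \<in> borel_measurable M" "tendsto_in_prob M (\<lambda>m. ?I (gs m)) J' sequentially" for gs J'
    using that(1) I_meas unfolding approx_def
    by (intro tendsto_in_prob_unique[OF sequentially_bot _ J(1) that(2) J(2)[OF that(1)] that(3)]) auto
  with J show ?thesis
    unfolding approx_def by (intro bexI[of _ J]) auto
qed

end
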